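(* Let $(T,f)$ and $(G,g)$ be merge trees and let $\varepsilon>0$. Then $$d_I(T,G)\le\max\{d_I(P_\varepsilon(T),P_\varepsilon(G)),\ \varepsilon/2\}.$$
   Context: **Merge trees.** A merge tree $(T,f)$ is a finite rooted tree with vertex set $V_T$ and root $r_T$, the root having order (number of incident edges) $>1$, together with an injective function $f:V_T\to\mathbb{R}$ which is monotone increasing for the partial order on $V_T$ generated by child $<$ father (so $r_T$ is the maximum). Leaves are the vertices with no children. The metric merge tree $\mathbf{T}$ is obtained by gluing, along common vertices, an interval $[f(x),f(x')]$ for each edge from a child $x$ to its father $x'$, and a half-line $[f(r_T),+\infty)$ at the root. It carries the shortest path metric, contains $V_T$, and $f$ and the partial order extend to it (for each $x$ the set $\{x'\ge x\}$ is a chain mapped by $f$ bijectively onto $[f(x),+\infty)$). For $k\ge 0$, $s_T^k(x)$ is the unique $x'\ge x$ with $f(x')=f(x)+k$. **Interleaving distance.** Continuous maps $\alpha:\mathbf{T}\to\mathbf{G}$, $\beta:\mathbf{G}\to\mathbf{T}$ are $\delta$-compatible ($\delta\ge0$) if $g(\alpha(x))=f(x)+\delta$ for all $x\in\mathbf{T}$, $f(\beta(y))=g(y)+\delta$ for all $y\in\mathbf{G}$, $\alpha\beta=s_G^{2\delta}$ and $\beta\alpha=s_T^{2\delta}$. The interleaving distance is $d_I(T,G)=d_I(\mathbf{T},\mathbf{G})=\inf\{\delta\mid\text{there exist }\delta\text{-compatible maps}\}$. **Pruning operator.** For $\varepsilon>0$, operation (P) on a merge tree is: take a leaf $l$ such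 that $f(\mathrm{father}(l))-f(l)$ is minimal; if $f(\mathrm{father}(l))-f(l)<\varepsilon$, remove $l$, and also remove its father if the father becomes an order $2$ vertex after removing $l$ (its two neighbours then being joined by an edge; for the root, the half-line above it is counted as an incident edge, so that a root left with exactly one child is removed and that child becomes the new root). Heights of the remaining vertices are unchanged. Starting from $T_0=T$ and applying (P) repeatedly gives $T_1,T_2,\dots$ until a fixed point $T_n=T_{n+1}$ is reached; this fixed point is $P_\varepsilon(T)$.
   Formalization: The formal theorem assumes that T and G have no order 2 vertices (no vertex below the root with exactly one child); with such vertices allowed, pruning can remove a long edge piece by piece and the inequality fails. *)

theory Defs
  imports "HOL-Analysis.Analysis"
begin

section \<open>Merge trees\<close>

text \<open>The pair \<open>(x, x') \<in> edges T\<close> is the edge from the child \<open>x\<close> to its father \<open>x'\<close>.\<close>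

record 'v htree =
  verts :: "'v set"
  edges :: "('v \<times> 'v) set"
  top_vertex :: 'v
  height :: "'v \<Rightarrow> real"

definition rooted_tree :: "'v htree \<Rightarrow> bool" where
  "rooted_tree T \<longleftrightarrow>
     finite (verts T) \<and> top_vertex T \<in> verts T \<and> edges T \<subseteq> verts T \<times> verts T \<and>
     (\<forall>v\<in>verts T - {top_vertex T}. \<exists>!p. (v, p) \<in> edges T) \<and>
     (\<forall>p. (top_vertex T, p) \<notin> edges T) \<and>
     (\<forall>v\<in>verts T. (v, top_vertex T) \<in> (edges T)\<^sup>*)"

definition leaf :: "'v htree \<Rightarrow> 'v \<Rightarrow> bool" where
  "leaf T v \<longleftrightarrow> v \<in> verts T \<and> (\<forall>c. (c, v) \<notin> edges T)"

definition incident :: "'v htree \<Rightarrow> 'v \<Rightarrow> ('v \<times> 'v) set" where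
  "incident T v = {e \<in> edges T. fst e = v \<or> snd e = v}"

definition vorder :: "'v htree \<Rightarrow> 'v \<Rightarrow> nat" where
  "vorder T v = card (incident T v)"

text \<open>The order of a vertex when the half-line above the root counts as an incident edge.\<close>

definition vorder_inf :: "'v htree \<Rightarrow> 'v \<Rightarrow> nat" where
  "vorder_inf T v = vorder T v + (if v = top_vertex T then 1 else 0)"

text \<open>Pruning can end in a single vertex, which has all the properties of a merge tree
  except that its root has order 0; the metric tree and the interleaving distance have to make
  sense for it as well. Hence the root condition is split off.\<close>

definition height_tree :: "'v htree \<Rightarrow> bool" where
  "height_tree T \<longleftrightarrow>
     rooted_tree T \<and> inj_on (height T) (verts T) \<and>
     (\<forall>(x, y)\<in>(edges T)\<^sup>*. x \<in> verts T \<longrightarrow> height T x \<le> height T y)"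

definition merge_tree :: "'v htree \<Rightarrow> bool" where
  "merge_tree T \<longleftrightarrow> height_tree T \<and> vorder T (top_vertex T) > 1"

text \<open>Merge trees are considered up to order 2 vertices, which (P) removes whenever it creates
  them; this predicate selects the representative without any. On subdivided edges (P) behaves
  differently: it may remove a long edge piece by piece, and then pruned trees are no longer
  close to the original tree.\<close>

definition no_order2 :: "'v htree \<Rightarrow> bool" where
  "no_order2 T \<longleftrightarrow> (\<forall>v\<in>verts T. vorder_inf T v \<noteq> 2)"


section \<open>The metric merge tree\<close>

text \<open>After gluing, every point lies in exactly one of the half-open intervals
  \<open>[f x, f x')\<close> (\<open>x'\<close> the father of \<open>x\<close>) or in the half-line \<open>[f r, \<infinity>)\<close>. The point at height
  \<open>h\<close> in the piece that starts at the vertex \<open>x\<close> is represented by \<open>(x, h)\<close>; the upper endpoint of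
  the edge from \<open>x\<close> to \<open>x'\<close> is the point \<open>(x', f x')\<close>, and a vertex \<open>x\<close> is the
  point \<open>(x, f x)\<close>. The extension of \<open>f\<close> to the metric tree is \<open>snd\<close>.\<close>

definition points :: "'v htree \<Rightarrow> ('v \<times> real) set" where
  "points T = {(v, h). v \<in> verts T \<and> height T v \<le> h \<and> (\<forall>p. (v, p) \<in> edges T \<longrightarrow> h < height T p)}"

definition below :: "'v htree \<Rightarrow> 'v \<times> real \<Rightarrow> 'v \<times> real \<Rightarrow> bool" where
  "below T x y \<longleftrightarrow> (fst x, fst y) \<in> (edges T)\<^sup>* \<and> snd x \<le> snd y"

text \<open>Paths are concatenations of vertical segments. Such a segment joins two
  comparable points and is isometric (via \<open>f\<close>) to a real interval. A path is given by the list of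
  its break points.\<close>

definition tree_path :: "'v htree \<Rightarrow> 'v \<times> real \<Rightarrow> ('v \<times> real) list \<Rightarrow> 'v \<times> real \<Rightarrow> bool" where
  "tree_path T x ps y \<longleftrightarrow>
     ps \<noteq> [] \<and> hd ps = x \<and> last ps = y \<and> set ps \<subseteq> points T \<and>
     successively (\<lambda>p q. below T p q \<or> below T q p) ps"

fun path_len :: "('v \<times> real) list \<Rightarrow> real" where
  "path_len (p # q # ps) = \<bar>snd q - snd p\<bar> + path_len (q # ps)"
| "path_len _ = 0"

definition tree_dist :: "'v htree \<Rightarrow> 'v \<times> real \<Rightarrow> 'v \<times> real \<Rightarrow> real" where
  "tree_dist T x y =
     (if x \<in> points T \<and> y \<in> points T then Inf {path_len ps | ps. tree_path T x ps y} else 0)"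

text \<open>That this is a metric is shown in \<open>Metric_space_tree\<close> below.\<close>

definition tree_topology :: "'v htree \<Rightarrow> ('v \<times> real) topology" where
  "tree_topology T = Metric_space.mtopology (points T) (tree_dist T)"

definition shift :: "'v htree \<Rightarrow> real \<Rightarrow> 'v \<times> real \<Rightarrow> 'v \<times> real" where
  "shift T k x = (THE y. y \<in> points T \<and> below T x y \<and> snd y = snd x + k)"


section \<open>Interleaving distance\<close>

definition compatible ::
  "'v htree \<Rightarrow> 'w htree \<Rightarrow> real \<Rightarrow> ('v \<times> real \<Rightarrow> 'w \<times> real) \<Rightarrow> ('w \<times> real \<Rightarrow> 'v \<times> real) \<Rightarrow> bool" where
  "compatible T G \<delta> \<alpha> \<beta> \<longleftrightarrow>
     0 \<le> \<delta> \<and>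
     continuous_map (tree_topology T) (tree_topology G) \<alpha> \<and>
     continuous_map (tree_topology G) (tree_topology T) \<beta> \<and>
     (\<forall>x\<in>points T. snd (\<alpha> x) = snd x + \<delta>) \<and>
     (\<forall>y\<in>points G. snd (\<beta> y) = snd y + \<delta>) \<and>
     (\<forall>y\<in>points G. \<alpha> (\<beta> y) = shift G (2 * \<delta>) y) \<and>
     (\<forall>x\<in>points T. \<beta> (\<alpha> x) = shift T (2 * \<delta>) x)"

text \<open>The infimum is taken in \<open>ereal\<close>, so that an infimum over the empty set would be \<open>\<infinity>\<close>.\<close>

definition interleaving_dist :: "'v htree \<Rightarrow> 'w htree \<Rightarrow> ereal" where
  "interleaving_dist T G = Inf {ereal \<delta> | \<delta>. \<exists>\<alpha> \<beta>. compatible T G \<delta> \<alpha> \<beta>}"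


section \<open>Pruning\<close>

definition delete_vertex :: "'v htree \<Rightarrow> 'v \<Rightarrow> 'v htree" where
  "delete_vertex T v = T\<lparr>verts := verts T - {v}, edges := edges T - incident T v\<rparr>"

text \<open>For an order 2 vertex \<open>p\<close> other than the root, the child and the father of \<open>p\<close> are joined; for
  a root with one child, no edge is added and the child is the new root.\<close>

definition remove_order2 :: "'v htree \<Rightarrow> 'v \<Rightarrow> 'v htree" where
  "remove_order2 T p =
     T\<lparr>verts := verts T - {p},
       edges := (edges T - incident T p) \<union> {(c, q). (c, p) \<in> edges T \<and> (p, q) \<in> edges T},
       top_vertex := (if p = top_vertex T then THE c. (c, p) \<in> edges T else top_vertex T)\<rparr>"

definition prune_leaf :: "'v htree \<Rightarrow> 'v \<Rightarrow> 'v \<Rightarrow> 'v htree" where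
  "prune_leaf T l p =
     (let U = delete_vertex T l in if vorder_inf U p = 2 then remove_order2 U p else U)"

text \<open>One application of the operation (P) that does remove a leaf. Several leaves may attain the
  minimum, and any of them may be chosen; so this is a relation.\<close>

definition prune_step :: "real \<Rightarrow> 'v htree \<Rightarrow> 'v htree \<Rightarrow> bool" where
  "prune_step \<epsilon> T T' \<longleftrightarrow>
     (\<exists>l p. leaf T l \<and> (l, p) \<in> edges T \<and>
        (\<forall>l' p'. leaf T l' \<and> (l', p') \<in> edges T \<longrightarrow>
           height T p - height T l \<le> height T p' - height T l') \<and>
        height T p - height T l < \<epsilon> \<and> T' = prune_leaf T l p)"

text \<open>\<open>T'\<close> is a possible value of \<open>P\<^sub>\<epsilon> T\<close>: the end of a maximal run of (P). By
  \<open>pruned_exists\<close> below there always is one.\<close>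

definition pruned :: "real \<Rightarrow> 'v htree \<Rightarrow> 'v htree \<Rightarrow> bool" where
  "pruned \<epsilon> T T' \<longleftrightarrow> (prune_step \<epsilon>)\<^sup>*\<^sup>* T T' \<and> (\<nexists>T''. prune_step \<epsilon> T' T'')"

lemma verts_prune_leaf:
  assumes "v \<in> verts T"
  shows "verts (prune_leaf T v p) \<subset> verts T"
  using assms by (auto simp: prune_leaf_def delete_vertex_def remove_order2_def Let_def)

lemma pruned_exists:
  assumes "finite (verts T)"
  shows "\<exists>T'. pruned \<epsilon> T T'"
  using assms
proof (induction "card (verts T)" arbitrary: T rule: less_induct)
  case less
  show ?case
  proof (cases "\<exists>U. prune_step \<epsilon> T U")
    case True
    then obtain U where U: "prune_step \<epsilon> T U" ..
    then have "verts U \<subset> verts T"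
      using verts_prune_leaf unfolding prune_step_def leaf_def by metis
    then obtain T' where "pruned \<epsilon> U T'"
      using less psubset_card_mono finite_subset by (metis psubset_imp_subset)
    with U show ?thesis
      unfolding pruned_def by (meson converse_rtranclp_into_rtranclp)
  next
    case False
    then show ?thesis by (auto simp: pruned_def)
  qed
qed


section \<open>The shortest path distance is a metric\<close>

context
  fixes T :: "'v htree"
  assumes T: "height_tree T"
begin

lemma edges_single_valued: "single_valued (edges T)"
  using T unfolding height_tree_def rooted_tree_def single_valued_def by blast

lemma height_mono: "(x, y) \<in> (edges T)\<^sup>* \<Longrightarrow> x \<in> verts T \<Longrightarrow> height T x \<le> height T y"
  using T unfolding height_tree_def by auto

lemma below_refl: "below T x x"
  by (simp add: below_def)

lemma below_trans: "below T x y \<Longrightarrow> below T y z \<Longrightarrow> below T x z"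
  unfolding below_def by (meson order_trans rtrancl_trans)

lemma edge_verts: "(x, p) \<in> edges T \<Longrightarrow> x \<in> verts T \<and> p \<in> verts T"
  using T unfolding height_tree_def rooted_tree_def by blast

lemma father_height:
  assumes "(v, w) \<in> (edges T)\<^sup>*" "v \<noteq> w" "(v, h) \<in> points T"
  shows "h < height T w"
proof -
  obtain p where p: "(v, p) \<in> edges T" "(p, w) \<in> (edges T)\<^sup>*"
    using assms(1,2) by (meson converse_rtranclE)
  have "h < height T p" using assms(3) p by (auto simp: points_def)
  also have "\<dots> \<le> height T w" using height_mono p edge_verts by blast
  finally show ?thesis .
qed

lemma below_linear:
  assumes "below T x y" "below T x z" "y \<in> points T" "z \<in> points T"
  shows "below T y z \<or> below T z y"
proof -
  have *: "below T y z" if "(fst y, fst z) \<in> (edges T)\<^sup>*" "fst y \<noteq> fst z"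
    "y \<in> points T" "z \<in> points T" for y z :: "'v \<times> real"
  proof -
    have "snd y < height T (fst z)" using father_height[OF that(1,2)] that(3) by simp
    also have "\<dots> \<le> snd z" using that(4) by (auto simp: points_def)
    finally show ?thesis using that by (simp add: below_def)
  qed
  have "(fst y, fst z) \<in> (edges T)\<^sup>* \<or> (fst z, fst y) \<in> (edges T)\<^sup>*"
    using single_valued_confluent[OF edges_single_valued] assms(1,2) by (auto simp: below_def)
  moreover have ?thesis if "fst y = fst z" using that by (auto simp: below_def)
  ultimately show ?thesis using * assms(3,4) by metis
qed

lemma tree_path_single: "x \<in> points T \<Longrightarrow> tree_path T x [x] x"
  by (simp add: tree_path_def)

lemma path_len_nonneg: "0 \<le> path_len ps"
  by (induction ps rule: path_len.induct) auto

lemma tree_path_Cons: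
  "tree_path T x (p # q # ps) y \<longleftrightarrow>
     p = x \<and> x \<in> points T \<and> (below T p q \<or> below T q p) \<and> tree_path T q (q # ps) y"
  unfolding tree_path_def by auto

lemma path_upper:
  assumes "tree_path T x ps y"
  shows "\<exists>z\<in>points T. below T x z \<and> below T y z \<and> 2 * snd z - snd x - snd y \<le> path_len ps"
  using assms
proof (induction ps arbitrary: x rule: path_len.induct)
  case (1 p q ps)
  then have xq: "x = p" "x \<in> points T" "below T x q \<or> below T q x" and "tree_path T q (q # ps) y"
    by (auto simp: tree_path_Cons)
  then obtain z where z: "z \<in> points T" "below T q z" "below T y z"
    "2 * snd z - snd q - snd y \<le> path_len (q # ps)" using 1 by blast
  have le: "snd q \<le> snd z" using z by (simp add: below_def)
  consider "below T x q" | "below T q x" "below T x z" | "below T q x" "below T z x"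
    using xq below_linear[of q x z] z by blast
  then show ?case
  proof cases
    case 1
    then show ?thesis using z xq below_trans[OF 1 z(2)] by (intro bexI[of _ z]) (auto simp: below_def)
  next
    case 2
    then show ?thesis using z xq by (intro bexI[of _ z]) (auto simp: below_def)
  next
    case 3
    then show ?thesis using z xq le below_refl below_trans[OF z(3)]
      by (intro bexI[of _ x]) (auto simp: below_def)
  qed
next
  case "2_1"
  then show ?case by (auto simp: tree_path_def)
next
  case ("2_2" v)
  then show ?case by (auto simp: tree_path_def below_refl intro!: bexI[of _ x])
qed

lemma path_len_append:
  "path_len (xs @ z # ys) = path_len (xs @ [z]) + path_len (z # ys)"
proof (induction xs rule: path_len.induct)
  case ("2_2" v)
  then show ?case by simp
qed auto

lemma path_len_rev: "path_len (rev ps) = path_len ps"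
proof (induction ps rule: path_len.induct)
  case (1 p q ps)
  have "path_len (rev (p # q # ps)) = path_len (rev ps @ q # [p])" by simp
  also have "\<dots> = path_len (rev (q # ps)) + path_len [q, p]"
    by (subst path_len_append) simp
  finally show ?case using 1 by simp
qed auto

lemma tree_path_rev: "tree_path T x ps y \<Longrightarrow> tree_path T y (rev ps) x"
  unfolding tree_path_def
  by (auto simp: hd_rev last_rev elim!: successively_mono)

lemma tree_path_append:
  assumes "tree_path T x ps y" "tree_path T y qs z"
  shows "\<exists>rs. tree_path T x rs z \<and> path_len rs = path_len ps + path_len qs"
proof -
  obtain ps' where ps: "ps = ps' @ [y]"
    using assms(1) unfolding tree_path_def by (metis append_butlast_last_id)
  obtain qs' where qs: "qs = y # qs'"
    using assms(2) unfolding tree_path_def by (metis list.collapse)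
  have "tree_path T x (ps' @ y # qs') z"
    using assms unfolding ps qs tree_path_def
    by (auto simp: successively_append_iff successively_Cons hd_append split: if_splits)
  then show ?thesis unfolding ps qs using path_len_append[of ps' y qs'] by blast
qed

lemma common_upper:
  assumes "x \<in> points T" "y \<in> points T"
  shows "\<exists>z\<in>points T. below T x z \<and> below T y z"
proof -
  let ?r = "top_vertex T"
  let ?z = "(?r, max (height T ?r) (max (snd x) (snd y)))"
  have "?z \<in> points T" using T by (auto simp: points_def height_tree_def rooted_tree_def)
  moreover have "below T w ?z" if "w \<in> points T" "w = x \<or> w = y" for w
    using T that by (auto simp: points_def height_tree_def rooted_tree_def below_def)
  ultimately show ?thesis using assms by blast
qed

lemma tree_path_exists:
  assumes "x \<in> points T" "y \<in> points T"
  shows "\<exists>ps. tree_path T x ps y"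
proof -
  obtain z where "z \<in> points T" "below T x z" "below T y z" using common_upper assms by blast
  then have "tree_path T x [x, z, y] y" using assms by (simp add: tree_path_def)
  then show ?thesis ..
qed

lemma tree_dist_le: "tree_path T x ps y \<Longrightarrow> tree_dist T x y \<le> path_len ps"
  unfolding tree_dist_def
  by (auto intro!: cInf_lower bdd_belowI[of _ 0] simp: path_len_nonneg)

lemma tree_dist_approx:
  assumes "x \<in> points T" "y \<in> points T" "tree_dist T x y < e"
  shows "\<exists>ps. tree_path T x ps y \<and> path_len ps < e"
proof -
  have "{path_len ps | ps. tree_path T x ps y} \<noteq> {}" using tree_path_exists assms by blast
  from cInf_lessD[OF this, of e] assms show ?thesis unfolding tree_dist_def by auto
qed

lemma below_small:
  assumes "x \<in> points T"
  shows "\<exists>e>0. \<forall>z\<in>points T. below T x z \<and> snd z - snd x < e \<longrightarrow> fst z = fst x"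
proof (cases "\<exists>p. (fst x, p) \<in> edges T")
  case True
  then obtain p where p: "(fst x, p) \<in> edges T" ..
  have "fst z = fst x" if z: "z \<in> points T" "below T x z" "snd z - snd x < height T p - snd x" for z
  proof (rule ccontr)
    assume "fst z \<noteq> fst x"
    then obtain q where q: "(fst x, q) \<in> edges T" "(q, fst z) \<in> (edges T)\<^sup>*"
      using z(2) unfolding below_def by (metis converse_rtranclE)
    have "q = p" using p q edges_single_valued by (auto dest: single_valuedD)
    then have "height T p \<le> height T (fst z)" using height_mono q edge_verts by blast
    also have "\<dots> \<le> snd z" using z by (auto simp: points_def)
    finally show False using z(3) by simp
  qed
  moreover have "0 < height T p - snd x" using p assms by (auto simp: points_def)
  ultimately show ?thesis by blast
next
  case False
  have "fst z = fst x" if "below T x z" for z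
    using that False unfolding below_def by (metis converse_rtranclE)
  then show ?thesis by (auto intro: exI[of _ 1])
qed

lemma Metric_space_tree: "Metric_space (points T) (tree_dist T)"
proof
  have nonneg: "0 \<le> tree_dist T x y" if "x \<in> points T" "y \<in> points T" for x y
    using tree_path_exists[OF that] that unfolding tree_dist_def
    by (auto intro!: cInf_greatest simp: path_len_nonneg)
  show "0 \<le> tree_dist T x y" for x y
    using nonneg unfolding tree_dist_def by auto
  show sym: "tree_dist T x y = tree_dist T y x" for x y
  proof -
    have "{path_len ps | ps. tree_path T x ps y} \<subseteq> {path_len ps | ps. tree_path T y ps x}" for x y
      using tree_path_rev path_len_rev by (smt (verit) Collect_mono)
    then show ?thesis unfolding tree_dist_def by (metis (no_types, lifting) subset_antisym)
  qed
  show "tree_dist T x y = 0 \<longleftrightarrow> x = y" if xy: "x \<in> points T" "y \<in> points T" for x y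
  proof
    assume "x = y"
    then show "tree_dist T x y = 0"
      using tree_dist_le[OF tree_path_single] nonneg xy by (metis antisym path_len.simps(3))
  next
    assume 0: "tree_dist T x y = 0"
    have ap: "\<exists>z\<in>points T. below T x z \<and> below T y z \<and> snd z - snd x < e \<and> snd z - snd y < e"
      if e: "e > 0" for e :: real
    proof -
      obtain ps where "tree_path T x ps y" "path_len ps < e"
        using tree_dist_approx[OF xy, of e] 0 e by auto
      then obtain z where z: "z \<in> points T" "below T x z" "below T y z"
        "2 * snd z - snd x - snd y < e" using path_upper by (meson order_le_less_trans)
      then show ?thesis by (intro bexI[of _ z]) (auto simp: below_def)
    qed
    obtain e1 where e1: "e1 > 0"
      "\<forall>z\<in>points T. below T x z \<and> snd z - snd x < e1 \<longrightarrow> fst z = fst x"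
      using below_small xy by blast
    obtain e2 where e2: "e2 > 0"
      "\<forall>z\<in>points T. below T y z \<and> snd z - snd y < e2 \<longrightarrow> fst z = fst y"
      using below_small xy by blast
    have "fst x = fst y" using ap[of "min e1 e2"] e1 e2 by (metis min_less_iff_conj)
    moreover have "snd x = snd y"
    proof (rule ccontr)
      assume "snd x \<noteq> snd y"
      then obtain z where "below T x z" "below T y z"
        "snd z - snd x < \<bar>snd x - snd y\<bar>" "snd z - snd y < \<bar>snd x - snd y\<bar>"
        using ap[of "\<bar>snd x - snd y\<bar>"] by (metis eq_iff_diff_eq_0 zero_less_abs_iff)
      then show False by (auto simp: below_def abs_if split: if_splits)
    qed
    ultimately show "x = y" by (simp add: prod_eq_iff)
  qed
  show "tree_dist T x z \<le> tree_dist T x y + tree_dist T y z"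
    if xyz: "x \<in> points T" "y \<in> points T" "z \<in> points T" for x y z
  proof (rule field_le_epsilon)
    fix e :: real assume "e > 0"
    obtain ps where ps: "tree_path T x ps y" "path_len ps < tree_dist T x y + e / 2"
      using tree_dist_approx xyz \<open>e > 0\<close> by (metis half_gt_zero less_add_same_cancel1)
    obtain qs where qs: "tree_path T y qs z" "path_len qs < tree_dist T y z + e / 2"
      using tree_dist_approx xyz \<open>e > 0\<close> by (metis half_gt_zero less_add_same_cancel1)
    show "tree_dist T x z \<le> tree_dist T x y + tree_dist T y z + e"
      using tree_path_append[OF ps(1) qs(1)] tree_dist_le ps(2) qs(2) by fastforce
  qed
qed

end

end

theory Submission
  imports Defs
begin

text \<open>
  The reason for the inequality is that a pruned tree \<open>T'\<close> sits inside \<open>T\<close> as a height preserving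
  retract: there are maps \<open>\<iota> : T' \<rightarrow> T\<close> and \<open>\<phi> : T \<rightarrow> T'\<close> which keep heights, satisfy \<open>\<phi> \<iota> = id\<close>, and
  for which \<open>\<iota> (\<phi> x)\<close> and \<open>x\<close> have merged after going up by \<open>\<epsilon>\<close>, that is
  \<open>s\<^sup>\<epsilon> \<iota> \<phi> = s\<^sup>\<epsilon>\<close> (\<open>pruned_retract\<close>). The map \<open>\<phi>\<close> can keep heights because the operation (P)
  always removes a leaf with the shortest edge: below the father of the removed leaf \<open>l\<close> there
  remains another leaf \<open>m\<close> at least as deep as \<open>l\<close> (\<open>deeper_leaf_exists\<close>), and the edge of \<open>l\<close> can
  be folded onto the path upwards from \<open>m\<close>. As the edge of \<open>l\<close> is shorter than \<open>\<epsilon>\<close>, a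
  point of this edge and its image have merged after \<open>\<epsilon>\<close>. Retractions with the same \<open>\<epsilon>\<close> compose to a
  retraction with that \<open>\<epsilon>\<close> (\<open>eps_retract_trans\<close>), so that the errors of the single steps do not add up.

  Let \<open>\<alpha>\<close>, \<open>\<beta>\<close> be \<open>\<delta>\<close>-compatible maps between \<open>T'\<close> and \<open>G'\<close>, let \<open>\<phi>\<^sub>T, \<iota>\<^sub>T\<close> and \<open>\<phi>\<^sub>G, \<iota>\<^sub>G\<close> be the maps
  of the two retractions, and let \<open>k \<ge> 0\<close> be least with \<open>2 (\<delta> + k) \<ge> \<epsilon>\<close>. Then \<open>\<iota>\<^sub>G s\<^sup>k \<alpha> \<phi>\<^sub>T\<close> and
  \<open>\<iota>\<^sub>T s\<^sup>k \<beta> \<phi>\<^sub>G\<close> are compatible for \<open>\<delta> + k = max \<delta> (\<epsilon> / 2)\<close>: as all maps commute with shifts, one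
  round trip is \<open>\<iota>\<^sub>G s\<^bsup>2\<delta>+2k\<^esup> \<phi>\<^sub>G = s\<^bsup>2\<delta>+2k\<^esup> \<iota>\<^sub>G \<phi>\<^sub>G = s\<^bsup>2\<delta>+2k\<^esup>\<close> (\<open>compatible_of_retracts\<close>).

  Topology enters only through \<open>compatible_iff_height_hom\<close>: a map which raises all heights
  by the same constant is continuous if and only if it is monotone, and monotone maps of this
  kind commute with shifts.
\<close>

section \<open>Vertical shifts\<close>

text \<open>Injectivity of the heights excludes equality unless the edge is a loop, and no path to the
  root starts at a vertex that is its own father.\<close>

lemma edge_height_less:
  assumes T: "height_tree T" and vp: "(v, p) \<in> edges T"
  shows "height T v < height T p"
proof -
  have verts: "v \<in> verts T" "p \<in> verts T" using edge_verts[OF T vp] by auto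
  have "v \<noteq> p"
  proof
    assume "v = p"
    have "w = v" if "(v, w) \<in> (edges T)\<^sup>*" for w
      using that
    proof induction
      case (step y z)
      then show ?case using edges_single_valued[OF T] vp \<open>v = p\<close> by (metis single_valuedD)
    qed simp
    then show False using T vp verts unfolding height_tree_def rooted_tree_def by metis
  qed
  then have "height T v \<noteq> height T p" using T verts unfolding height_tree_def by (meson inj_onD)
  moreover have "height T v \<le> height T p" using height_mono[OF T] vp verts by blast
  ultimately show ?thesis by simp
qed

lemma below_antisym:
  assumes "height_tree T" "below T x y" "below T y x" "x \<in> points T"
  shows "x = y"
proof -
  have "height T (fst x) = height T (fst y)" "fst x \<in> verts T" "fst y \<in> verts T"
  proof -
    show x: "fst x \<in> verts T" using assms(4) by (auto simp: points_def)
    show y: "fst y \<in> verts T"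
      using assms(2) x edge_verts[OF assms(1)] unfolding below_def by (metis rtranclE)
    show "height T (fst x) = height T (fst y)"
      using height_mono[OF assms(1)] assms(2,3) x y by (meson antisym below_def)
  qed
  then have "fst x = fst y"
    using assms(1) unfolding height_tree_def by (meson inj_onD)
  then show ?thesis using assms(2,3) by (auto simp: below_def prod_eq_iff)
qed

lemma below_of_common_lower:
  assumes "height_tree T" "below T x y" "below T x z" "y \<in> points T" "z \<in> points T" "snd y \<le> snd z"
  shows "below T y z"
proof (cases "below T z y")
  case True
  show ?thesis
  proof (cases "fst z = fst y")
    case False
    then have "snd z < height T (fst y)"
      using father_height[OF assms(1), of "fst z" "fst y" "snd z"] True assms(5) by (simp add: below_def)
    also have "\<dots> \<le> snd y" using assms(4) by (auto simp: points_def)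
    finally show ?thesis using assms(6) by simp
  qed (use assms(6) in \<open>simp add: below_def\<close>)
qed (use below_linear assms in blast)

text \<open>The vertex \<open>w\<close> is the highest one above \<open>x\<close> of height at most \<open>h\<close>; its father, if there is
  one, is higher than \<open>h\<close> by maximality.\<close>

lemma point_above_exists:
  assumes T: "height_tree T" and x: "x \<in> points T" and h: "snd x \<le> h"
  shows "\<exists>w. (w, h) \<in> points T \<and> below T x (w, h)"
proof -
  define A where "A = {w \<in> verts T. (fst x, w) \<in> (edges T)\<^sup>* \<and> height T w \<le> h}"
  have "finite A" using T by (simp add: A_def height_tree_def rooted_tree_def)
  moreover have "fst x \<in> A" using x h by (auto simp: A_def points_def)
  ultimately have "Max (height T ` A) \<in> height T ` A" by (intro Max_in) auto
  then obtain w where w: "w \<in> A" and "height T w = Max (height T ` A)" by auto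
  then have max: "height T v \<le> height T w" if "v \<in> A" for v
    using that \<open>finite A\<close> by simp
  have "h < height T p" if p: "(w, p) \<in> edges T" for p
  proof (rule ccontr)
    assume "\<not> h < height T p"
    then have "p \<in> A" using w p edge_verts[OF T] by (auto simp: A_def)
    then show False using max edge_height_less[OF T p] by fastforce
  qed
  then show ?thesis using w h by (auto simp: points_def below_def A_def)
qed

lemma shift_unique:
  assumes "height_tree T" "y \<in> points T" "below T x y" "snd y = snd x + k"
  shows "shift T k x = y"
  unfolding shift_def
proof (rule the_equality)
  fix z assume z: "z \<in> points T \<and> below T x z \<and> snd z = snd x + k"
  then have "below T y z" "below T z y"
    using assms below_of_common_lower[OF assms(1)] by (metis order_refl)+
  then show "z = y" using below_antisym z assms(1) by blast
qed (use assms in blast)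

lemma shift_props:
  assumes "height_tree T" "x \<in> points T" "0 \<le> k"
  shows "shift T k x \<in> points T" "below T x (shift T k x)" "snd (shift T k x) = snd x + k"
proof -
  obtain w where w: "(w, snd x + k) \<in> points T" "below T x (w, snd x + k)"
    using point_above_exists assms by (metis le_add_same_cancel1)
  then have "shift T k x = (w, snd x + k)" using assms(1) by (intro shift_unique) auto
  then show "shift T k x \<in> points T" "below T x (shift T k x)" "snd (shift T k x) = snd x + k"
    using w by auto
qed

lemma shift_mono:
  assumes T: "height_tree T" and xy: "below T x y" "x \<in> points T" "y \<in> points T"
    and "0 \<le> k" "0 \<le> m" "snd x + k \<le> snd y + m"
  shows "below T (shift T k x) (shift T m y)"
proof (rule below_of_common_lower[OF T])
  show "below T x (shift T k x)" "below T x (shift T m y)"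
    using shift_props(2)[OF T] below_trans[OF T xy(1)] assms by auto
  show "shift T k x \<in> points T" "shift T m y \<in> points T" "snd (shift T k x) \<le> snd (shift T m y)"
    using shift_props[OF T] assms by auto
qed

lemma shift_shift:
  assumes T: "height_tree T" and "x \<in> points T" "0 \<le> k" "0 \<le> m"
  shows "shift T k (shift T m x) = shift T (k + m) x"
proof -
  note m = shift_props[OF T assms(2,4)]
  note k = shift_props[OF T m(1) assms(3)]
  show ?thesis
    using k m below_trans[OF T m(2) k(2)] by (intro shift_unique[OF T, symmetric]) auto
qed


section \<open>Monotone maps that raise heights by a constant\<close>

definition height_hom ::
  "'v htree \<Rightarrow> 'w htree \<Rightarrow> real \<Rightarrow> ('v \<times> real \<Rightarrow> 'w \<times> real) \<Rightarrow> bool" where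
  "height_hom T G \<delta> \<alpha> \<longleftrightarrow>
     (\<forall>x\<in>points T. \<alpha> x \<in> points G \<and> snd (\<alpha> x) = snd x + \<delta>) \<and>
     (\<forall>x\<in>points T. \<forall>y\<in>points T. below T x y \<longrightarrow> below G (\<alpha> x) (\<alpha> y))"

lemma height_hom_comp:
  assumes "height_hom T G a \<alpha>" "height_hom G H b \<beta>"
  shows "height_hom T H (a + b) (\<beta> \<circ> \<alpha>)"
  using assms unfolding height_hom_def by simp

lemma height_hom_shift: "height_tree T \<Longrightarrow> 0 \<le> k \<Longrightarrow> height_hom T T k (shift T k)"
  unfolding height_hom_def using shift_props shift_mono by (metis add_le_cancel_right below_def)

lemma height_hom_commutes_shift:
  assumes "height_tree T" "height_tree G" "height_hom T G \<delta> \<alpha>" "x \<in> points T" "0 \<le> k"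
  shows "\<alpha> (shift T k x) = shift G k (\<alpha> x)"
  using assms(3,4) shift_props[OF assms(1,4,5)] unfolding height_hom_def
  by (intro shift_unique[OF assms(2), symmetric]) auto

text \<open>The image of a path is a path with the same height differences.\<close>

lemma tree_dist_height_hom:
  assumes T: "height_tree T" and G: "height_tree G" and \<alpha>: "height_hom T G \<delta> \<alpha>"
    and xy: "x \<in> points T" "y \<in> points T"
  shows "tree_dist G (\<alpha> x) (\<alpha> y) \<le> tree_dist T x y"
proof (rule field_le_epsilon)
  fix e :: real assume "e > 0"
  then obtain ps where ps: "tree_path T x ps y" "path_len ps < tree_dist T x y + e"
    using tree_dist_approx[OF T xy] by (metis less_add_same_cancel1)
  have sub: "set ps \<subseteq> points T" using ps(1) by (simp add: tree_path_def)
  have "successively (\<lambda>p q. below G (\<alpha> p) (\<alpha> q) \<or> below G (\<alpha> q) (\<alpha> p)) ps"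
    using ps(1) \<alpha> unfolding tree_path_def height_hom_def
    by (auto elim!: successively_mono)
  then have "tree_path G (\<alpha> x) (map \<alpha> ps) (\<alpha> y)"
    using ps(1) \<alpha> by (auto simp: tree_path_def successively_map hd_map last_map height_hom_def)
  moreover have "path_len (map \<alpha> ps) = path_len ps"
    using sub
  proof (induction ps rule: path_len.induct)
    case (1 p q ps)
    then show ?case using \<alpha> by (simp add: height_hom_def)
  qed auto
  ultimately show "tree_dist G (\<alpha> x) (\<alpha> y) \<le> tree_dist T x y + e"
    using tree_dist_le[OF G] ps(2) by fastforce
qed

lemma continuous_tree_map_iff:
  assumes T: "height_tree T" and G: "height_tree G"
  shows "continuous_map (tree_topology T) (tree_topology G) \<alpha> \<longleftrightarrow>
    \<alpha> ` points T \<subseteq> points G \<and>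
    (\<forall>a\<in>points T. \<forall>e>0. \<exists>d>0. \<forall>x. x \<in> points T \<and> tree_dist T a x < d \<longrightarrow>
       tree_dist G (\<alpha> a) (\<alpha> x) < e)"
  unfolding tree_topology_def
  by (rule Metric_space.metric_continuous_map[OF Metric_space_tree[OF T] Metric_space_tree[OF G]])

lemma continuous_height_hom:
  assumes "height_tree T" "height_tree G" "height_hom T G \<delta> \<alpha>"
  shows "continuous_map (tree_topology T) (tree_topology G) \<alpha>"
  unfolding continuous_tree_map_iff[OF assms(1,2)]
proof (intro conjI ballI allI impI)
  show "\<alpha> ` points T \<subseteq> points G" using assms(3) by (auto simp: height_hom_def)
  fix a and e :: real assume "a \<in> points T" "0 < e"
  then show "\<exists>d>0. \<forall>x. x \<in> points T \<and> tree_dist T a x < d \<longrightarrow> tree_dist G (\<alpha> a) (\<alpha> x) < e"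
    using tree_dist_height_hom[OF assms, of a] by (intro exI[of _ e]) force
qed

text \<open>A point near \<open>y\<close> has a common upper bound \<open>w\<close> with \<open>y\<close> that is only slightly higher than
  \<open>y\<close>, hence on the same edge as \<open>y\<close>. So the points near \<open>y\<close> lie on this edge or hang below \<open>y\<close>, and none of
  them is on a side branch that joins above \<open>y\<close>.\<close>

lemma near_imp_comparable:
  assumes T: "height_tree T" and y: "y \<in> points T"
  shows "\<exists>e>0. \<forall>z\<in>points T. tree_dist T y z < e \<longrightarrow>
    (snd z \<le> snd y \<longrightarrow> below T z y) \<and> (snd y \<le> snd z \<longrightarrow> below T y z)"
proof -
  obtain e where e: "e > 0" "\<And>w. w \<in> points T \<Longrightarrow> below T y w \<Longrightarrow> snd w - snd y < e \<Longrightarrow> fst w = fst y"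
    using below_small[OF T y] by blast
  have "(snd z \<le> snd y \<longrightarrow> below T z y) \<and> (snd y \<le> snd z \<longrightarrow> below T y z)"
    if z: "z \<in> points T" "tree_dist T y z < e" for z
  proof -
    obtain ps where "tree_path T y ps z" "path_len ps < e"
      using tree_dist_approx[OF T y z] by blast
    then obtain w where w: "w \<in> points T" "below T y w" "below T z w" "2 * snd w - snd y - snd z < e"
      using path_upper[OF T] by (meson order_le_less_trans)
    then have "fst w = fst y" by (intro e(2)) (auto simp: below_def)
    then have zy: "(fst z, fst y) \<in> (edges T)\<^sup>*" using w(3) by (simp add: below_def)
    moreover have "fst z = fst y" if "snd y \<le> snd z"
    proof (rule ccontr)
      assume "fst z \<noteq> fst y"
      then have "snd z < height T (fst y)"
        using father_height[OF T zy, of "snd z"] z(1) by simp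
      also have "\<dots> \<le> snd y" using y by (auto simp: points_def)
      finally show False using that by simp
    qed
    ultimately show ?thesis by (auto simp: below_def)
  qed
  then show ?thesis using e(1) by blast
qed

text \<open>Go up from \<open>x\<close> to \<open>y\<close>, through the points \<open>s\<^sup>t(x)\<close>. Two images \<open>\<alpha> (s\<^sup>a(x))\<close>, \<open>\<alpha> (s\<^sup>b(x))\<close> with
  \<open>a \<le> t \<le> b\<close> close to \<open>t\<close> are close to \<open>\<alpha> (s\<^sup>t(x))\<close>, hence one below and one above it, by their
  heights. Being below is transitive, so this local statement extends to the whole interval
  by bisection.\<close>

lemma height_hom_of_continuous:
  assumes T: "height_tree T" and G: "height_tree G"
    and cont: "continuous_map (tree_topology T) (tree_topology G) \<alpha>"
    and ht: "\<And>x. x \<in> points T \<Longrightarrow> snd (\<alpha> x) = snd x + \<delta>"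
  shows "height_hom T G \<delta> \<alpha>"
proof -
  note c = cont[unfolded continuous_tree_map_iff[OF T G]]
  have "below G (\<alpha> x) (\<alpha> y)" if x: "x \<in> points T" and y: "y \<in> points T" and xy: "below T x y" for x y
  proof -
    define u where "u t = shift T t x" for t
    note u = shift_props[OF T x, folded u_def]
    have \<alpha>u: "\<alpha> (u s) \<in> points G" "snd (\<alpha> (u s)) = snd x + s + \<delta>" if "0 \<le> s" for s
      using u[OF that] ht[of "u s"] conjunct1[OF c] by auto
    \<comment> \<open>The bisection rule also asks for intervals that start to the left of 0, where the
      shift is not specified; this is the reason for the guard.\<close>
    define P where "P a b \<longleftrightarrow> (0 \<le> a \<longrightarrow> below G (\<alpha> (u a)) (\<alpha> (u b)))" for a b
    have "0 \<le> snd y - snd x" using xy by (simp add: below_def)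
    then have "P 0 (snd y - snd x)"
    proof (induction rule: Bolzano)
      case (trans a b c)
      then show ?case using below_trans[OF G] unfolding P_def by (meson order_trans)
    next
      case (local t)
      then have t: "u t \<in> points T" "0 \<le> t" using u by auto
      then have "\<alpha> (u t) \<in> points G" using c by auto
      then obtain e where e: "e > 0" "\<And>z. z \<in> points G \<Longrightarrow> tree_dist G (\<alpha> (u t)) z < e \<Longrightarrow>
          (snd z \<le> snd (\<alpha> (u t)) \<longrightarrow> below G z (\<alpha> (u t))) \<and>
          (snd (\<alpha> (u t)) \<le> snd z \<longrightarrow> below G (\<alpha> (u t)) z)"
        using near_imp_comparable[OF G] by blast
      obtain d where d: "d > 0" "\<And>z. z \<in> points T \<Longrightarrow> tree_dist T (u t) z < d \<Longrightarrow>
          tree_dist G (\<alpha> (u t)) (\<alpha> z) < e"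
        using c t(1) e(1) by meson
      have near: "tree_dist G (\<alpha> (u t)) (\<alpha> (u s)) < e" if s: "0 \<le> s" "\<bar>s - t\<bar> < d" for s
      proof -
        have "below T (u t) (u s) \<or> below T (u s) (u t)"
          using shift_mono[OF T below_refl[OF T] x x, of s t] shift_mono[OF T below_refl[OF T] x x, of t s]
            s(1) t(2) unfolding u_def by (cases "s \<le> t") auto
        then have "tree_path T (u t) [u t, u s] (u s)" using u(1) s(1) t(1) by (simp add: tree_path_def)
        from tree_dist_le[OF T this] have "tree_dist T (u t) (u s) < d" using s t(2) u(3) by simp
        then show ?thesis using d(2) u(1) s(1) by blast
      qed
      have "below G (\<alpha> (u a)) (\<alpha> (u b))" if ab: "a \<le> t" "t \<le> b" "b - a < d" "0 \<le> a" for a b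
      proof -
        have "below G (\<alpha> (u a)) (\<alpha> (u t))"
          using e(2)[OF \<alpha>u(1) near, of a] \<alpha>u(2)[of a] \<alpha>u(2)[of t] ab t(2) by simp
        moreover have "below G (\<alpha> (u t)) (\<alpha> (u b))"
          using e(2)[OF \<alpha>u(1) near, of b] \<alpha>u(2)[of b] \<alpha>u(2)[of t] ab t(2) by simp
        ultimately show ?thesis using below_trans[OF G] by blast
      qed
      then show ?case using d(1) unfolding P_def by blast
    qed
    moreover have "u 0 = x" unfolding u_def using x below_refl[OF T] by (intro shift_unique[OF T]) auto
    moreover have "u (snd y - snd x) = y" unfolding u_def using y xy by (intro shift_unique[OF T]) auto
    ultimately show ?thesis by (simp add: P_def)
  qed
  then show ?thesis using c ht unfolding height_hom_def by auto
qed

lemma compatible_iff_height_hom: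
  assumes T: "height_tree T" and G: "height_tree G"
  shows "compatible T G \<delta> \<alpha> \<beta> \<longleftrightarrow>
    0 \<le> \<delta> \<and> height_hom T G \<delta> \<alpha> \<and> height_hom G T \<delta> \<beta> \<and>
    (\<forall>y\<in>points G. \<alpha> (\<beta> y) = shift G (2 * \<delta>) y) \<and>
    (\<forall>x\<in>points T. \<beta> (\<alpha> x) = shift T (2 * \<delta>) x)"
proof -
  have *: "continuous_map (tree_topology H) (tree_topology K) \<gamma> \<and> (\<forall>x\<in>points H. snd (\<gamma> x) = snd x + \<delta>)
      \<longleftrightarrow> height_hom H K \<delta> \<gamma>" if "height_tree H" "height_tree K"
    for H :: "'x htree" and K :: "'y htree" and \<gamma>
  proof
    assume "height_hom H K \<delta> \<gamma>"
    then show "continuous_map (tree_topology H) (tree_topology K) \<gamma> \<and> (\<forall>x\<in>points H. snd (\<gamma> x) = snd x + \<delta>)"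
      using continuous_height_hom[OF that] by (simp add: height_hom_def)
  qed (use height_hom_of_continuous[OF that] in simp)
  show ?thesis unfolding compatible_def *[OF T G, symmetric] *[OF G T, symmetric] by argo
qed

section \<open>Retracts and interleavings\<close>

text \<open>How far the projection moves a point is measured by the height at which the point and its
  image have merged, since this is what the shifts in the definition of compatible maps detect.\<close>

definition eps_retract :: "real \<Rightarrow> 'v htree \<Rightarrow> 'v htree \<Rightarrow> bool" where
  "eps_retract \<epsilon> T U \<longleftrightarrow>
     (\<exists>\<iota> \<phi>. height_hom U T 0 \<iota> \<and> height_hom T U 0 \<phi> \<and> (\<forall>x\<in>points U. \<phi> (\<iota> x) = x) \<and>
        (\<forall>x\<in>points T. shift T \<epsilon> (\<iota> (\<phi> x)) = shift T \<epsilon> x))"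

lemma eps_retract_refl: "eps_retract \<epsilon> T T"
  unfolding eps_retract_def height_hom_def by (intro exI[of _ id]) auto

text \<open>The same \<open>\<epsilon>\<close> is kept because the inclusion of \<open>U\<close> commutes with the shift by \<open>\<epsilon>\<close>, which
  absorbs the inner projection \<open>U \<rightarrow> W \<rightarrow> U\<close> first and the outer one afterwards.\<close>

lemma eps_retract_trans:
  assumes T: "height_tree T" and U: "height_tree U" and "0 \<le> \<epsilon>"
    and TU: "eps_retract \<epsilon> T U" and UW: "eps_retract \<epsilon> U W"
  shows "eps_retract \<epsilon> T W"
proof -
  obtain i f where 1: "height_hom U T 0 i" "height_hom T U 0 f" "\<And>x. x \<in> points U \<Longrightarrow> f (i x) = x"
    "\<And>x. x \<in> points T \<Longrightarrow> shift T \<epsilon> (i (f x)) = shift T \<epsilon> x"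
    using TU unfolding eps_retract_def by blast
  obtain j g where 2: "height_hom W U 0 j" "height_hom U W 0 g" "\<And>x. x \<in> points W \<Longrightarrow> g (j x) = x"
    "\<And>x. x \<in> points U \<Longrightarrow> shift U \<epsilon> (j (g x)) = shift U \<epsilon> x"
    using UW unfolding eps_retract_def by blast
  have "shift T \<epsilon> (i (j (g (f x)))) = shift T \<epsilon> x" if x: "x \<in> points T" for x
  proof -
    have fx: "f x \<in> points U" "j (g (f x)) \<in> points U"
      using 1 2 x unfolding height_hom_def by auto
    have "shift T \<epsilon> (i (j (g (f x)))) = i (shift U \<epsilon> (j (g (f x))))"
      using height_hom_commutes_shift[OF U T 1(1) fx(2)] \<open>0 \<le> \<epsilon>\<close> by simp
    also have "\<dots> = i (shift U \<epsilon> (f x))" using 2(4) fx by simp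
    also have "\<dots> = shift T \<epsilon> (i (f x))"
      using height_hom_commutes_shift[OF U T 1(1) fx(1)] \<open>0 \<le> \<epsilon>\<close> by simp
    finally show ?thesis using 1(4) x by simp
  qed
  moreover have "g (f (i (j x))) = x" if "x \<in> points W" for x
    using that 1(3) 2(1,3) by (auto simp: height_hom_def)
  ultimately show ?thesis
    using height_hom_comp[OF 2(1) 1(1)] height_hom_comp[OF 1(2) 2(2)]
    unfolding eps_retract_def by (intro exI[of _ "i \<circ> j"] exI[of _ "g \<circ> f"]) auto
qed

text \<open>One of the two round trips. It is stated for two arbitrary trees, so that it also gives the
  other one by exchanging their roles.\<close>

lemma round_trip_of_retracts:
  assumes T: "height_tree T" and T': "height_tree T'"
    and G: "height_tree G" and G': "height_tree G'"
    and fi: "\<And>x. x \<in> points T' \<Longrightarrow> f (i x) = x"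
    and shG: "\<And>x. x \<in> points G \<Longrightarrow> shift G \<epsilon> (j (g x)) = shift G \<epsilon> x"
    and j: "height_hom G' G 0 j" and g: "height_hom G G' 0 g"
    and \<alpha>: "height_hom T' G' \<delta> \<alpha>" and \<beta>: "height_hom G' T' \<delta> \<beta>"
    and \<alpha>\<beta>: "\<And>y. y \<in> points G' \<Longrightarrow> \<alpha> (\<beta> y) = shift G' (2 * \<delta>) y"
    and k: "0 \<le> k" "0 \<le> \<delta>" "0 \<le> \<epsilon>" "\<epsilon> \<le> 2 * (\<delta> + k)"
    and y: "y \<in> points G"
  shows "(j \<circ> (shift G' k \<circ> (\<alpha> \<circ> f))) ((i \<circ> (shift T' k \<circ> (\<beta> \<circ> g))) y) = shift G (2 * (\<delta> + k)) y"
proof -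
  have gy: "g y \<in> points G'" "j (g y) \<in> points G" "\<beta> (g y) \<in> points T'"
    using y g j \<beta> by (auto simp: height_hom_def)
  have "f (i (shift T' k (\<beta> (g y)))) = shift T' k (\<beta> (g y))"
    using fi shift_props(1)[OF T' gy(3) k(1)] by blast
  then have "\<alpha> (f (i (shift T' k (\<beta> (g y))))) = shift G' k (shift G' (2 * \<delta>) (g y))"
    using height_hom_commutes_shift[OF T' G' \<alpha> gy(3) k(1)] \<alpha>\<beta>[OF gy(1)] by simp
  then have "shift G' k (\<alpha> (f (i (shift T' k (\<beta> (g y)))))) = shift G' (k + (k + 2 * \<delta>)) (g y)"
    using shift_shift[OF G' gy(1)] k(1,2) by simp
  also have "k + (k + 2 * \<delta>) = 2 * (\<delta> + k)" by simp
  finally have "j (shift G' k (\<alpha> (f (i (shift T' k (\<beta> (g y))))))) = shift G (2 * (\<delta> + k)) (j (g y))"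
    using height_hom_commutes_shift[OF G' G j gy(1)] k by simp
  moreover have "shift G (2 * (\<delta> + k)) z = shift G (2 * (\<delta> + k) - \<epsilon>) (shift G \<epsilon> z)"
    if "z \<in> points G" for z
    using shift_shift[OF G that, of "2 * (\<delta> + k) - \<epsilon>" \<epsilon>] k by simp
  ultimately show ?thesis using shG[OF y] y gy(2) by simp
qed

lemma compatible_of_retracts:
  assumes T: "height_tree T" and T': "height_tree T'" and G: "height_tree G" and G': "height_tree G'"
    and "0 \<le> \<epsilon>" and rT: "eps_retract \<epsilon> T T'" and rG: "eps_retract \<epsilon> G G'"
    and comp: "compatible T' G' \<delta> \<alpha> \<beta>"
  shows "\<exists>\<alpha>' \<beta>'. compatible T G (max \<delta> (\<epsilon> / 2)) \<alpha>' \<beta>'"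
proof -
  \<comment> \<open>The height by which the given maps have to be raised additionally; it vanishes
    if \<open>\<delta> \<ge> \<epsilon> / 2\<close>.\<close>
  define k where "k = max \<delta> (\<epsilon> / 2) - \<delta>"
  obtain i f where i: "height_hom T' T 0 i" and f: "height_hom T T' 0 f"
    and fi: "\<And>x. x \<in> points T' \<Longrightarrow> f (i x) = x"
    and shT: "\<And>x. x \<in> points T \<Longrightarrow> shift T \<epsilon> (i (f x)) = shift T \<epsilon> x"
    using rT unfolding eps_retract_def by blast
  obtain j g where j: "height_hom G' G 0 j" and g: "height_hom G G' 0 g"
    and gj: "\<And>x. x \<in> points G' \<Longrightarrow> g (j x) = x"
    and shG: "\<And>x. x \<in> points G \<Longrightarrow> shift G \<epsilon> (j (g x)) = shift G \<epsilon> x"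
    using rG unfolding eps_retract_def by blast
  have k: "0 \<le> k" "0 \<le> \<delta>" "\<delta> + k = max \<delta> (\<epsilon> / 2)" "\<epsilon> \<le> 2 * (\<delta> + k)"
    using comp by (auto simp: k_def compatible_def)
  note c = comp[unfolded compatible_iff_height_hom[OF T' G']]
  have "compatible T G (\<delta> + k) (j \<circ> (shift G' k \<circ> (\<alpha> \<circ> f))) (i \<circ> (shift T' k \<circ> (\<beta> \<circ> g)))"
    unfolding compatible_iff_height_hom[OF T G]
  proof (intro conjI ballI)
    show "0 \<le> \<delta> + k" using k by simp
    show "height_hom T G (\<delta> + k) (j \<circ> (shift G' k \<circ> (\<alpha> \<circ> f)))"
      using height_hom_comp[OF height_hom_comp[OF height_hom_comp[OF f] height_hom_shift[OF G' k(1)]] j] c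
      by simp
    show "height_hom G T (\<delta> + k) (i \<circ> (shift T' k \<circ> (\<beta> \<circ> g)))"
      using height_hom_comp[OF height_hom_comp[OF height_hom_comp[OF g] height_hom_shift[OF T' k(1)]] i] c
      by simp
  next
    fix y assume "y \<in> points G"
    then show "(j \<circ> (shift G' k \<circ> (\<alpha> \<circ> f))) ((i \<circ> (shift T' k \<circ> (\<beta> \<circ> g))) y) = shift G (2 * (\<delta> + k)) y"
      using c k \<open>0 \<le> \<epsilon>\<close> by (intro round_trip_of_retracts[OF T T' G G' _ _ j g]) (auto simp: fi shG)
  next
    fix x assume "x \<in> points T"
    then show "(i \<circ> (shift T' k \<circ> (\<beta> \<circ> g))) ((j \<circ> (shift G' k \<circ> (\<alpha> \<circ> f))) x) = shift T (2 * (\<delta> + k)) x"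
      using c k \<open>0 \<le> \<epsilon>\<close> by (intro round_trip_of_retracts[OF G G' T T' _ _ i f]) (auto simp: gj shT)
  qed
  then show ?thesis unfolding k(3) by blast
qed

section \<open>Deleting a leaf\<close>

text \<open>Points of equal height that have merged at \<open>z\<close> remain together from there on.\<close>

lemma shift_eq_of_common_upper:
  assumes T: "height_tree T" and z: "z \<in> points T" "below T x z" "below T y z"
    and "snd x = snd y" "snd z \<le> snd x + k"
  shows "shift T k x = shift T k y"
proof -
  define w where "w = shift T (snd x + k - snd z) z"
  have w: "w \<in> points T" "below T z w" "snd w = snd x + k"
    using shift_props[OF T z(1), of "snd x + k - snd z"] assms by (auto simp: w_def)
  then show ?thesis
    using shift_unique[OF T w(1), of x k] shift_unique[OF T w(1), of y k]
      below_trans[OF T z(2) w(2)] below_trans[OF T z(3) w(2)] assms by simp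
qed

lemma vertex_in_points:
  assumes "height_tree T" "v \<in> verts T"
  shows "(v, height T v) \<in> points T"
  using assms edge_height_less by (auto simp: points_def)

locale leaf_edge =
  fixes T :: "'v htree" and l p :: 'v
  assumes T: "height_tree T" and l: "leaf T l" and lp: "(l, p) \<in> edges T"
begin

abbreviation "U \<equiv> delete_vertex T l"

lemma edges_delete_leaf: "edges U = {(a, b) \<in> edges T. a \<noteq> l}"
  using l by (auto simp: delete_vertex_def incident_def leaf_def)

lemma delete_leaf_simps [simp]:
  "verts U = verts T - {l}" "top_vertex U = top_vertex T" "height U = height T"
  by (auto simp: delete_vertex_def)

lemma reach_leaf: "(v, l) \<in> (edges T)\<^sup>* \<Longrightarrow> v = l"
  using l by (auto simp: leaf_def elim: rtranclE)

lemma reach_delete_leaf: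
  assumes "(v, w) \<in> (edges T)\<^sup>*" "v \<noteq> l"
  shows "(v, w) \<in> (edges U)\<^sup>*"
  using assms
proof induction
  case (step y z)
  then have "y \<noteq> l" using reach_leaf by blast
  with step show ?case unfolding edges_delete_leaf by (auto intro: rtrancl_into_rtrancl)
qed simp

lemma reach_of_delete_leaf: "(v, w) \<in> (edges U)\<^sup>* \<Longrightarrow> (v, w) \<in> (edges T)\<^sup>*"
  by (rule subsetD[OF rtrancl_mono]) (auto simp: edges_delete_leaf)

lemma points_delete_leaf: "points U = {x \<in> points T. fst x \<noteq> l}"
  by (auto simp: points_def edges_delete_leaf)

lemma height_tree_delete_leaf: "height_tree U"
proof -
  have "top_vertex T \<noteq> l" using T lp by (auto simp: height_tree_def rooted_tree_def)
  have "rooted_tree U"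
    unfolding rooted_tree_def
  proof (intro conjI ballI allI)
    show "finite (verts U)" "top_vertex U \<in> verts U" "edges U \<subseteq> verts U \<times> verts U"
      "(top_vertex U, q) \<notin> edges U" for q
      using T l \<open>top_vertex T \<noteq> l\<close> by (auto simp: height_tree_def rooted_tree_def edges_delete_leaf leaf_def)
  next
    fix v assume v: "v \<in> verts U - {top_vertex U}"
    then have "\<exists>!q. (v, q) \<in> edges T" using T by (auto simp: height_tree_def rooted_tree_def)
    then show "\<exists>!q. (v, q) \<in> edges U" using v by (simp add: edges_delete_leaf)
  next
    fix v assume v: "v \<in> verts U"
    then show "(v, top_vertex U) \<in> (edges U)\<^sup>*"
      using T reach_delete_leaf[of v "top_vertex T"] by (auto simp: height_tree_def rooted_tree_def)
  qed
  moreover have "inj_on (height U) (verts U)"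
    using T by (auto simp: height_tree_def intro: inj_on_subset)
  ultimately show ?thesis
    using height_mono[OF T] reach_of_delete_leaf unfolding height_tree_def by auto
qed

text \<open>The projection folds the edge from \<open>l\<close> to \<open>p\<close> onto the path from \<open>m\<close> to \<open>p\<close>. This path
  reaches down at least as far as \<open>l\<close>, so the projection can keep heights. A point and its
  image meet at \<open>p\<close> at the latest.\<close>

lemma eps_retract_delete_leaf:
  assumes m: "m \<in> verts T" "m \<noteq> l" "(m, p) \<in> (edges T)\<^sup>*" "height T m \<le> height T l"
    and \<epsilon>: "height T p - height T l \<le> \<epsilon>"
  shows "eps_retract \<epsilon> T U"
proof -
  note U = height_tree_delete_leaf
  define m0 where "m0 = (m, height T m)"
  have m0: "m0 \<in> points U" using vertex_in_points[OF T m(1)] m(2) by (simp add: m0_def points_delete_leaf)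
  define \<phi> where "\<phi> x = (if fst x = l then shift U (snd x - height T m) m0 else x)" for x
  have l_pt: "height T l \<le> snd x" "snd x < height T p" if "x \<in> points T" "fst x = l" for x
    using that lp by (auto simp: points_def)
  have slid: "\<phi> x \<in> points U" "below U m0 (\<phi> x)" "snd (\<phi> x) = snd x" if "x \<in> points T" "fst x = l" for x
    using shift_props[OF U m0, of "snd x - height T m"] l_pt[OF that] m(4) that
    by (auto simp: \<phi>_def m0_def)
  have \<phi>_pt: "\<phi> x \<in> points U \<and> snd (\<phi> x) = snd x" if "x \<in> points T" for x
    using slid[OF that] that by (cases "fst x = l") (auto simp: \<phi>_def points_delete_leaf)
  have mono: "below U (\<phi> x) (\<phi> y)" if x: "x \<in> points T" and y: "y \<in> points T" and xy: "below T x y" for x y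
  proof (cases "fst x = l")
    case False
    then have "fst y \<noteq> l" using xy reach_leaf by (auto simp: below_def)
    then show ?thesis using False xy reach_delete_leaf by (simp add: \<phi>_def below_def)
  next
    case xl: True
    have le: "snd x \<le> snd y" using xy by (simp add: below_def)
    show ?thesis
    proof (cases "fst y = l")
      case True
      have "below U m0 (\<phi> y)" using slid[OF y True] by simp
      then show ?thesis
        using below_of_common_lower[OF U slid(2)[OF x xl]] \<phi>_pt[OF x] \<phi>_pt[OF y] le by simp
    next
      case False
      then obtain q where q: "(l, q) \<in> edges T" "(q, fst y) \<in> (edges T)\<^sup>*"
        using xy xl unfolding below_def by (metis converse_rtranclE)
      have "q = p" using q lp edges_single_valued[OF T] by (auto dest: single_valuedD)
      then have "(m, fst y) \<in> (edges U)\<^sup>*"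
        using q m(2,3) reach_delete_leaf rtrancl_trans by metis
      then have "below U m0 (\<phi> y)"
        using False le l_pt[OF x xl] m(4) by (simp add: below_def m0_def \<phi>_def)
      then show ?thesis
        using below_of_common_lower[OF U slid(2)[OF x xl]] \<phi>_pt[OF x] \<phi>_pt[OF y] le by simp
    qed
  qed
  have "shift T \<epsilon> (\<phi> x) = shift T \<epsilon> x" if x: "x \<in> points T" for x
  proof (cases "fst x = l")
    case True
    have z: "(p, height T p) \<in> points T" using vertex_in_points[OF T] edge_verts[OF T lp] by simp
    have "below T x (p, height T p)" using True lp l_pt[OF x True] by (auto simp: below_def)
    moreover have "below T (\<phi> x) (p, height T p)"
    proof (rule below_of_common_lower[OF T])
      show "below T m0 (\<phi> x)"
        using slid(2)[OF x True] reach_of_delete_leaf by (auto simp: below_def)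
      show "below T m0 (p, height T p)"
        using m height_mono[OF T] by (simp add: below_def m0_def)
      show "\<phi> x \<in> points T" using \<phi>_pt[OF x] by (simp add: points_delete_leaf)
      show "snd (\<phi> x) \<le> snd (p, height T p)" using \<phi>_pt[OF x] l_pt[OF x True] by simp
    qed (rule z)
    ultimately show ?thesis
      using \<epsilon> l_pt[OF x True] \<phi>_pt[OF x] by (intro shift_eq_of_common_upper[OF T z]) auto
  qed (simp add: \<phi>_def)
  moreover have "height_hom T U 0 \<phi>" using \<phi>_pt mono by (simp add: height_hom_def)
  moreover have "height_hom U T 0 id"
    using reach_of_delete_leaf by (auto simp: height_hom_def points_delete_leaf below_def)
  moreover have "\<phi> x = x" if "x \<in> points U" for x
    using that by (simp add: \<phi>_def points_delete_leaf)
  ultimately show ?thesis unfolding eps_retract_def by (intro exI[of _ id] exI[of _ \<phi>]) simp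
qed

end

section \<open>Suppressing a vertex with a single child\<close>

locale single_child =
  fixes T :: "'v htree" and c p :: 'v
  assumes T: "height_tree T" and cp: "(c, p) \<in> edges T"
    and only_child: "\<And>a. (a, p) \<in> edges T \<Longrightarrow> a = c"
begin

abbreviation "U \<equiv> remove_order2 T p"

lemma father_unique: "(v, a) \<in> edges T \<Longrightarrow> (v, b) \<in> edges T \<Longrightarrow> a = b"
  using edges_single_valued[OF T] by (auto dest: single_valuedD)

lemma child_edge_iff: "(c, b) \<in> edges T \<longleftrightarrow> b = p"
  using father_unique cp by blast

lemma edge_to_iff: "(a, p) \<in> edges T \<longleftrightarrow> a = c"
  using only_child cp by blast

lemma no_loop: "(v, v) \<notin> edges T"
  using edge_height_less[OF T] by blast

lemma edges_suppress:
  "(a, b) \<in> edges U \<longleftrightarrow> (a, b) \<in> edges T \<and> a \<noteq> p \<and> b \<noteq> p \<or> a = c \<and> (p, b) \<in> edges T"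
  by (auto simp: remove_order2_def incident_def edge_to_iff)

lemma suppress_simps [simp]:
  "verts U = verts T - {p}" "height U = height T"
  "top_vertex U = (if p = top_vertex T then c else top_vertex T)"
proof -
  have "(THE a. (a, p) \<in> edges T) = c" by (simp add: edge_to_iff)
  then show "top_vertex U = (if p = top_vertex T then c else top_vertex T)"
    by (auto simp: remove_order2_def)
qed (simp_all add: remove_order2_def)

lemma c_neq_p: "c \<noteq> p"
  using cp no_loop by blast

lemma reach_of_suppress:
  assumes "(v, w) \<in> (edges U)\<^sup>*"
  shows "(v, w) \<in> (edges T)\<^sup>*"
  using assms
proof induction
  case (step y z)
  then have "(y, z) \<in> (edges T)\<^sup>*" using cp by (auto simp: edges_suppress)
  with step show ?case by simp
qed simp

text \<open>Contracting the edge from \<open>c\<close> to \<open>p\<close> to the vertex \<open>c\<close> turns paths into paths.\<close>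

lemma reach_suppress:
  assumes "(v, w) \<in> (edges T)\<^sup>*"
  shows "(if v = p then c else v, if w = p then c else w) \<in> (edges U)\<^sup>*"
  using assms
proof induction
  case (step y z)
  have "(if y = p then c else y, if z = p then c else z) \<in> (edges U)\<^sup>*"
    using step(2) no_loop by (auto simp: edges_suppress edge_to_iff)
  with step(3) show ?case by simp
qed simp

lemma reach_from_child:
  assumes "(c, w) \<in> (edges T)\<^sup>*" "w \<noteq> c"
  shows "(p, w) \<in> (edges T)\<^sup>*"
  using assms by (metis child_edge_iff converse_rtranclE)

lemma height_tree_suppress: "height_tree U"
proof -
  note rt = T[unfolded height_tree_def rooted_tree_def]
  have verts: "c \<in> verts T" "p \<in> verts T" using edge_verts[OF T cp] by auto
  have "rooted_tree U"
    unfolding rooted_tree_def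
  proof (intro conjI ballI allI)
    show "finite (verts U)" "top_vertex U \<in> verts U"
      using rt verts c_neq_p by auto
    show "edges U \<subseteq> verts U \<times> verts U"
      using edge_verts[OF T] verts c_neq_p no_loop by (auto simp: edges_suppress)
    have "c \<noteq> top_vertex T" using rt cp by blast
    then show "(top_vertex U, q) \<notin> edges U" for q
      using rt by (auto simp: edges_suppress child_edge_iff)
  next
    fix v assume v: "v \<in> verts U - {top_vertex U}"
    show "\<exists>!q. (v, q) \<in> edges U"
    proof (cases "v = c")
      case True
      then have "p \<in> verts T - {top_vertex T}" using v verts by auto
      then have "\<exists>!q. (p, q) \<in> edges T" using rt by blast
      moreover have "(v, q) \<in> edges U \<longleftrightarrow> (p, q) \<in> edges T" for q
        using True by (auto simp: edges_suppress child_edge_iff)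
      ultimately show ?thesis by simp
    next
      case False
      then have "v \<in> verts T - {top_vertex T}" using v by (auto split: if_splits)
      then have "\<exists>!q. (v, q) \<in> edges T" using rt by blast
      moreover have "(v, q) \<in> edges U \<longleftrightarrow> (v, q) \<in> edges T" for q
        using False v by (auto simp: edges_suppress edge_to_iff)
      ultimately show ?thesis by simp
    qed
  next
    fix v assume v: "v \<in> verts U"
    then have "(v, top_vertex T) \<in> (edges T)\<^sup>*" using rt by auto
    from reach_suppress[OF this] show "(v, top_vertex U) \<in> (edges U)\<^sup>*"
      using v by (auto split: if_splits)
  qed
  moreover have "inj_on (height U) (verts U)"
    using rt by (auto intro: inj_on_subset)
  ultimately show ?thesis
    using height_mono[OF T] reach_of_suppress unfolding height_tree_def by auto
qed

text \<open>The metric tree is unchanged up to isomorphism: the piece of points that starts at \<open>p\<close> is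
  appended to the edge that starts at the only child \<open>c\<close>. This covers the case that \<open>p\<close> is the
  root, where the piece is the half-line.\<close>

lemma eps_retract_suppress: "eps_retract \<epsilon> T U"
proof -
  define \<iota> where "\<iota> x = (if fst x = c \<and> height T p \<le> snd x then (p, snd x) else x)" for x :: "'v \<times> real"
  define \<phi> where "\<phi> x = (if fst x = p then (c, snd x) else x)" for x :: "'v \<times> real"
  have hcp: "height T c < height T p" using edge_height_less[OF T cp] .
  have c_le: "snd x < height T p" if "x \<in> points T" "fst x = c" for x
    using that cp by (auto simp: points_def)
  have p_ge: "height T p \<le> snd x" if "x \<in> points T" "fst x = p" for x
    using that by (auto simp: points_def)
  have \<iota>_pt: "\<iota> x \<in> points T" if "x \<in> points U" for x
  proof -
    obtain v h where x: "x = (v, h)" by (cases x)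
    show ?thesis using that edge_verts[OF T cp] c_neq_p
      by (cases "v = c") (auto simp: x \<iota>_def points_def edges_suppress edge_to_iff child_edge_iff)
  qed
  have \<phi>_pt: "\<phi> x \<in> points U" if "x \<in> points T" for x
  proof -
    obtain v h where x: "x = (v, h)" by (cases x)
    have "h < height T q" if "h < height T p" "(p, q) \<in> edges T" for q
      using that edge_height_less[OF T that(2)] by simp
    then show ?thesis using that edge_verts[OF T cp] c_neq_p hcp
      by (auto simp: x \<phi>_def points_def edges_suppress child_edge_iff)
  qed
  have "height_hom U T 0 \<iota>"
  proof -
    have "below T (\<iota> x) (\<iota> y)" if xy: "below U x y" for x y
    proof -
      have reach: "(fst x, fst y) \<in> (edges T)\<^sup>*" and le: "snd x \<le> snd y"
        using xy reach_of_suppress by (auto simp: below_def)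
      have up: "(fst x, p) \<in> (edges T)\<^sup>*" if "fst y = c"
        using rtrancl_into_rtrancl[OF reach] cp that by simp
      have "(p, fst y) \<in> (edges T)\<^sup>*" if "fst x = c" "fst y \<noteq> c"
        using reach reach_from_child that by simp
      then show ?thesis using reach up le by (auto simp: below_def \<iota>_def)
    qed
    then show ?thesis using \<iota>_pt by (auto simp: height_hom_def \<iota>_def)
  qed
  moreover have "height_hom T U 0 \<phi>"
  proof -
    have "below U (\<phi> x) (\<phi> y)" if "below T x y" for x y
      using that reach_suppress[of "fst x" "fst y"] by (auto simp: below_def \<phi>_def)
    then show ?thesis using \<phi>_pt by (auto simp: height_hom_def \<phi>_def)
  qed
  moreover have "\<phi> (\<iota> x) = x" if "x \<in> points U" for x
    using that by (auto simp: \<iota>_def \<phi>_def points_def)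
  moreover have "\<iota> (\<phi> x) = x" if "x \<in> points T" for x
    using c_le[OF that] p_ge[OF that] by (auto simp: \<iota>_def \<phi>_def prod_eq_iff)
  ultimately show ?thesis unfolding eps_retract_def by (intro exI[of _ \<iota>] exI[of _ \<phi>]) simp
qed

end

section \<open>Pruning\<close>

text \<open>No vertex has exactly one child. This is the absence of order 2 vertices, expressed by
  edges only, which makes it easy to follow through a pruning step.\<close>

definition branching :: "'v htree \<Rightarrow> bool" where
  "branching T \<longleftrightarrow> (\<forall>c p. (c, p) \<in> edges T \<longrightarrow> (\<exists>a. a \<noteq> c \<and> (a, p) \<in> edges T))"

text \<open>The upward edge, or the half-line in the case of the root, contributes 1.\<close>

lemma vorder_inf_eq_children:
  assumes T: "height_tree T" and v: "v \<in> verts T"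
  shows "vorder_inf T v = card {c. (c, v) \<in> edges T} + 1"
proof -
  note rt = T[unfolded height_tree_def rooted_tree_def]
  define C where "C = (\<lambda>c. (c, v)) ` {c. (c, v) \<in> edges T}"
  have "C \<subseteq> edges T" by (auto simp: C_def)
  moreover have "finite (edges T)" using rt by (meson finite_SigmaI finite_subset)
  ultimately have "finite C" by (rule finite_subset)
  have card_C: "card C = card {c. (c, v) \<in> edges T}"
    unfolding C_def by (intro card_image inj_onI) simp
  show ?thesis
  proof (cases "v = top_vertex T")
    case True
    then have "incident T v = C" using rt by (auto simp: incident_def C_def)
    then show ?thesis using True card_C by (simp add: vorder_inf_def vorder_def)
  next
    case False
    then obtain q where q: "\<And>b. (v, b) \<in> edges T \<longleftrightarrow> b = q"
      using rt v by blast
    have "(v, q) \<notin> C" using edge_height_less[OF T, of v q] q by (auto simp: C_def)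
    moreover have "incident T v = insert (v, q) C"
      using q by (auto simp: incident_def C_def)
    ultimately show ?thesis using False card_C \<open>finite C\<close> by (simp add: vorder_inf_def vorder_def)
  qed
qed

lemma branching_of_no_order2:
  assumes T: "height_tree T" and "no_order2 T"
  shows "branching T"
  unfolding branching_def
proof (intro allI impI)
  fix c p assume cp: "(c, p) \<in> edges T"
  show "\<exists>a. a \<noteq> c \<and> (a, p) \<in> edges T"
  proof (rule ccontr)
    assume "\<not> ?thesis"
    then have "{a. (a, p) \<in> edges T} = {c}" using cp by auto
    then have "vorder_inf T p = 2"
      using vorder_inf_eq_children[OF T, of p] edge_verts[OF T cp] by simp
    then show False using assms(2) edge_verts[OF T cp] by (simp add: no_order2_def)
  qed
qed

lemma leaf_below_exists:
  assumes T: "height_tree T" and v: "v \<in> verts T"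
  shows "\<exists>m. leaf T m \<and> (m, v) \<in> (edges T)\<^sup>*"
proof -
  define A where "A = {m \<in> verts T. (m, v) \<in> (edges T)\<^sup>*}"
  have "finite A" "A \<noteq> {}" using T v by (auto simp: A_def height_tree_def rooted_tree_def)
  then have "Min (height T ` A) \<in> height T ` A" by (intro Min_in) auto
  then obtain m where m: "m \<in> A" "height T m = Min (height T ` A)" by auto
  have "(c, m) \<notin> edges T" for c
  proof
    assume cm: "(c, m) \<in> edges T"
    then have "c \<in> A" using m edge_verts[OF T cm] by (auto simp: A_def)
    then have "height T m \<le> height T c" using m \<open>finite A\<close> by simp
    then show False using edge_height_less[OF T cm] by simp
  qed
  then show ?thesis using m by (auto simp: A_def leaf_def)
qed

text \<open>This is where (P) depends on the choice of a shortest edge and on branching. As \<open>p\<close> has a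
  second child, there is a leaf \<open>m\<close> below that child. The edge of \<open>m\<close> is at least as long as the
  edge of \<open>l\<close> and ends at \<open>p\<close> or below \<open>p\<close>, so it starts at the height of \<open>l\<close> or lower.\<close>

lemma deeper_leaf_exists:
  assumes T: "height_tree T" and "branching T" and lp: "(l, p) \<in> edges T"
    and min: "\<And>m q. leaf T m \<Longrightarrow> (m, q) \<in> edges T \<Longrightarrow>
      height T p - height T l \<le> height T q - height T m"
  obtains m where "m \<in> verts T" "m \<noteq> l" "(m, p) \<in> (edges T)\<^sup>*" "height T m \<le> height T l"
proof -
  obtain c where c: "c \<noteq> l" "(c, p) \<in> edges T"
    using \<open>branching T\<close> lp by (auto simp: branching_def)
  obtain m where m: "leaf T m" "(m, c) \<in> (edges T)\<^sup>*"
    using leaf_below_exists[OF T] edge_verts[OF T c(2)] by blast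
  obtain q where q: "(m, q) \<in> edges T" "(q, p) \<in> (edges T)\<^sup>*"
  proof (cases "m = c")
    case True
    then show thesis using that c by blast
  next
    case False
    then obtain q where "(m, q) \<in> edges T" "(q, c) \<in> (edges T)\<^sup>*"
      using m(2) by (metis converse_rtranclE)
    then show thesis using that c by (meson rtrancl_into_rtrancl)
  qed
  have "m \<noteq> l"
  proof
    assume "m = l"
    then have "(p, c) \<in> (edges T)\<^sup>*"
      using m(2) c(1) lp edges_single_valued[OF T] by (metis converse_rtranclE single_valuedD)
    then have "height T p \<le> height T c" using height_mono[OF T] edge_verts[OF T lp] by blast
    then show False using edge_height_less[OF T c(2)] by simp
  qed
  moreover have "height T q \<le> height T p" using height_mono[OF T q(2)] edge_verts[OF T q(1)] by simp
  then have "height T m \<le> height T l" using min[OF m(1) q(1)] by simp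
  ultimately show thesis using that q m(1) by (meson leaf_def converse_rtrancl_into_rtrancl)
qed

text \<open>A pruning step deletes a leaf and then, possibly, suppresses its father; both are
  retractions. Branching is an invariant: the father is the only vertex that loses a
  child, and it is suppressed if just one is left. The suppression itself replaces \<open>p\<close> by \<open>c\<close> among
  the children of the father of \<open>p\<close>.\<close>

lemma prune_step_retract:
  assumes T: "height_tree T" and br: "branching T" and step: "prune_step \<epsilon> T T'"
  shows "height_tree T' \<and> branching T' \<and> eps_retract \<epsilon> T T'"
proof -
  obtain l p where l: "leaf T l" and lp: "(l, p) \<in> edges T"
    and min: "\<And>m q. leaf T m \<Longrightarrow> (m, q) \<in> edges T \<Longrightarrow>
      height T p - height T l \<le> height T q - height T m"
    and \<epsilon>: "height T p - height T l < \<epsilon>" and T': "T' = prune_leaf T l p"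
    using step unfolding prune_step_def by blast
  interpret del: leaf_edge T l p by unfold_locales (fact T l lp)+
  define U where "U = delete_vertex T l"
  note U = del.height_tree_delete_leaf[folded U_def]
  have edges_U: "(a, b) \<in> edges U \<longleftrightarrow> (a, b) \<in> edges T \<and> a \<noteq> l" for a b
    by (auto simp: U_def del.edges_delete_leaf)
  obtain m where "m \<in> verts T" "m \<noteq> l" "(m, p) \<in> (edges T)\<^sup>*" "height T m \<le> height T l"
    using deeper_leaf_exists[OF T br lp min] by blast
  then have TU: "eps_retract \<epsilon> T U"
    using del.eps_retract_delete_leaf \<epsilon> unfolding U_def by simp
  have "0 \<le> \<epsilon>" using \<epsilon> edge_height_less[OF T lp] by simp
  obtain c where c: "(c, p) \<in> edges U"
    using br lp edges_U unfolding branching_def by metis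
  have p: "p \<in> verts U" using edge_verts[OF U c] by simp
  \<comment> \<open>Only the father of the deleted leaf has lost a child.\<close>
  have br_U: "\<exists>a'. a' \<noteq> a \<and> (a', b) \<in> edges U" if ab: "(a, b) \<in> edges U" "b \<noteq> p" for a b
  proof -
    obtain a' where a': "a' \<noteq> a" "(a', b) \<in> edges T"
      using br ab edges_U unfolding branching_def by metis
    then have "a' \<noteq> l" using ab(2) lp edges_single_valued[OF T] by (auto dest: single_valuedD)
    then show ?thesis using a' edges_U by blast
  qed
  show ?thesis
  proof (cases "vorder_inf U p = 2")
    case False
    then have "card {c. (c, p) \<in> edges U} \<noteq> 1" using vorder_inf_eq_children[OF U p] by simp
    then have "{c. (c, p) \<in> edges U} \<noteq> {a}" for a by auto
    then have "\<exists>a'. a' \<noteq> a \<and> (a', p) \<in> edges U" if "(a, p) \<in> edges U" for a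
      using that by blast
    then have "branching U" using br_U unfolding branching_def by metis
    moreover have "T' = U" using False T' by (simp add: prune_leaf_def U_def Let_def)
    ultimately show ?thesis using U TU by simp
  next
    case True
    then have "card {c. (c, p) \<in> edges U} = 1" using vorder_inf_eq_children[OF U p] by simp
    then have "{c. (c, p) \<in> edges U} = {c}" using c by (metis card_1_singletonE mem_Collect_eq singletonD)
    then interpret sup: single_child U c p using U c by unfold_locales auto
    have T'_eq: "T' = remove_order2 U p" using True T' by (simp add: prune_leaf_def U_def Let_def)
    have "\<exists>a'. a' \<noteq> a \<and> (a', b) \<in> edges T'" if ab: "(a, b) \<in> edges T'" for a b
    proof -
      consider "(a, b) \<in> edges U" "a \<noteq> p" "b \<noteq> p" | "a = c" "(p, b) \<in> edges U"
        using ab unfolding T'_eq sup.edges_suppress by blast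
      then show ?thesis
      proof cases
        case 1
        then obtain a' where a': "a' \<noteq> a" "(a', b) \<in> edges U" using br_U by blast
        show ?thesis
        proof (cases "a' = p")
          case True
          then have "(c, b) \<in> edges T'" using a' by (simp add: T'_eq sup.edges_suppress)
          moreover have "c \<noteq> a" using 1 sup.cp sup.father_unique by blast
          ultimately show ?thesis by blast
        qed (use a' 1 in \<open>auto simp: T'_eq sup.edges_suppress\<close>)
      next
        case 2
        then have "b \<noteq> p" using sup.no_loop by blast
        then obtain a' where a': "a' \<noteq> p" "(a', b) \<in> edges U" using br_U 2 by blast
        then have "a' \<noteq> c" using sup.cp sup.father_unique \<open>b \<noteq> p\<close> by blast
        then show ?thesis using a' 2 \<open>b \<noteq> p\<close> by (auto simp: T'_eq sup.edges_suppress)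
      qed
    qed
    then have "branching T'" by (auto simp: branching_def)
    moreover have "height_tree T'" using sup.height_tree_suppress by (simp add: T'_eq)
    moreover have "eps_retract \<epsilon> T T'"
      using eps_retract_trans[OF T U \<open>0 \<le> \<epsilon>\<close> TU] sup.eps_retract_suppress by (simp add: T'_eq)
    ultimately show ?thesis by blast
  qed
qed

lemma pruned_retract:
  assumes T: "height_tree T" and "no_order2 T" and "0 \<le> \<epsilon>" and "pruned \<epsilon> T T'"
  shows "height_tree T' \<and> eps_retract \<epsilon> T T'"
proof -
  have "(prune_step \<epsilon>)\<^sup>*\<^sup>* T T'" using assms(4) by (simp add: pruned_def)
  then have "height_tree T' \<and> branching T' \<and> eps_retract \<epsilon> T T'"
  proof induction
    case base
    show ?case using T branching_of_no_order2[OF T assms(2)] eps_retract_refl by blast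
  next
    case (step U V)
    then show ?case using prune_step_retract eps_retract_trans[OF T _ assms(3)] by blast
  qed
  then show ?thesis by blast
qed

theorem proposition4:
  fixes T T' :: "'v htree" and G G' :: "'w htree" and \<epsilon> :: real
  assumes "merge_tree T" and "merge_tree G"
    and "no_order2 T" and "no_order2 G"
    and "\<epsilon> > 0"
    and "pruned \<epsilon> T T'" and "pruned \<epsilon> G G'"
  shows "interleaving_dist T G \<le> max (interleaving_dist T' G') (ereal (\<epsilon> / 2))"
proof (rule ccontr)
  have T: "height_tree T" and G: "height_tree G" using assms(1,2) by (auto simp: merge_tree_def)
  have \<epsilon>: "0 \<le> \<epsilon>" using assms(5) by simp
  have T': "height_tree T'" "eps_retract \<epsilon> T T'" using pruned_retract[OF T assms(3) \<epsilon> assms(6)] by auto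
  have G': "height_tree G'" "eps_retract \<epsilon> G G'" using pruned_retract[OF G assms(4) \<epsilon> assms(7)] by auto
  assume "\<not> ?thesis"
  then have less: "interleaving_dist T' G' < interleaving_dist T G"
    and half: "ereal (\<epsilon> / 2) < interleaving_dist T G"
    by (simp_all add: not_le)
  from less obtain \<delta> \<alpha> \<beta> where \<delta>: "ereal \<delta> < interleaving_dist T G" and "compatible T' G' \<delta> \<alpha> \<beta>"
    unfolding interleaving_dist_def[of T' G'] Inf_less_iff by blast
  then obtain \<alpha>' \<beta>' where "compatible T G (max \<delta> (\<epsilon> / 2)) \<alpha>' \<beta>'"
    using compatible_of_retracts[OF T T'(1) G G'(1) \<epsilon> T'(2) G'(2)] by blast
  then have "interleaving_dist T G \<le> ereal (max \<delta> (\<epsilon> / 2))"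
    unfolding interleaving_dist_def by (intro Inf_lower) blast
  then show False using \<delta> half by (simp add: max_def split: if_splits)
qed
end
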